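(* Let $A\in\mathbb{R}^{n\times n}$, $B=[B_1\ \cdots\ B_m]\in\mathbb{R}^{n\times m}$ (columns $B_i$), $E=[E_1^{\top}\ \cdots\ E_m^{\top}]^{\top}\in\mathbb{R}^{m\times n}_+$ (rows $E_i\ne 0$), $s\in\mathbb{R}^n$ and $r\in\mathbb{R}^m$ be such that $A-|B|E$ is Metzler and $s\ge E^{\top}|r|$. If $p\in\mathbb{R}^n_+$ solves $$A^{\top}p=E^{\top}\left|r+B^{\top}p\right|-s,$$ $K$ satisfies $$K\in\begin{bmatrix}\operatorname{sign}(r_1+p^{\top}B_1)E_1\\ \vdots\\ \operatorname{sign}(r_m+p^{\top}B_m)E_m\end{bmatrix},$$ and $K$ is such that the pair $(s^{\top}-r^{\top}K,\ A-BK)$ is detectable, then $p$, together with $\zeta=|r+B^{\top}p|$, maximizes the linear program $$\text{maximize } \mathbf{1}^{\top}p \ \text{ over } p\in\mathbb{R}^n_+,\ \zeta\in\mathbb{R}^m_+ \quad\text{subject to } A^{\top}p\ge E^{\top}\zeta-s,\quad -\zeta\le r+B^{\top}p\le\zeta.$$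
   Context: Inequalities between vectors or matrices are elementwise, $|X|$ denotes the elementwise absolute value, and $\mathbb{R}^n_+$, $\mathbb{R}^{m\times n}_+$ denote vectors/matrices with nonnegative entries. $\mathbf{1}$ is the all-ones vector. A square matrix is Metzler if its off-diagonal entries are nonnegative. The signum is set-valued: $\operatorname{sign}(y)=\{+1\}$ if $y>0$, $\{-1\}$ if $y<0$, and $[-1,1]$ if $y=0$; the inclusion for $K$ means that the $i$-th row of $K$ is $\sigma E_i$ for some $\sigma\in\operatorname{sign}(r_i+p^{\top}B_i)$. A pair $(C,M)$ (system $\dot x=Mx$, $y=Cx$) is detectable if all unobservable states are (asymptotically) stable. *)

theory Defs
  imports "HOL-Analysis.Analysis"
begin

definition metzler :: "real ^ 'n ^ 'n \<Rightarrow> bool" where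
  "metzler M \<longleftrightarrow> (\<forall>i j. i \<noteq> j \<longrightarrow> 0 \<le> M $ i $ j)"

definition sign_set :: "real \<Rightarrow> real set" where
  "sign_set y = (if 0 < y then {1} else if y < 0 then {-1} else {-1..1})"

definition trajectory :: "real ^ 'n ^ 'n \<Rightarrow> (real \<Rightarrow> real ^ 'n) \<Rightarrow> bool" where
  "trajectory M x \<longleftrightarrow>
     (\<forall>t\<ge>0. (x has_vector_derivative M *v x t) (at t within {0..}))"

text \<open>
  Every state starts exactly one trajectory of a linear system, so whether the next two
  definitions quantify existentially or universally over trajectories is immaterial.
\<close>

definition unobservable_state ::
    "real ^ 'n ^ 'k \<Rightarrow> real ^ 'n ^ 'n \<Rightarrow> real ^ 'n \<Rightarrow> bool" where
  "unobservable_state C M x0 \<longleftrightarrow>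
     (\<exists>x. trajectory M x \<and> x 0 = x0 \<and> (\<forall>t\<ge>0. C *v x t = 0))"

definition asymptotically_stable_state :: "real ^ 'n ^ 'n \<Rightarrow> real ^ 'n \<Rightarrow> bool" where
  "asymptotically_stable_state M x0 \<longleftrightarrow>
     (\<forall>x. trajectory M x \<and> x 0 = x0 \<longrightarrow> (x \<longlongrightarrow> 0) at_top)"

definition detectable :: "real ^ 'n ^ 'k \<Rightarrow> real ^ 'n ^ 'n \<Rightarrow> bool" where
  "detectable C M \<longleftrightarrow>
     (\<forall>x0. unobservable_state C M x0 \<longrightarrow> asymptotically_stable_state M x0)"

text \<open>
  Order and absolute value on vectors and matrices are the library's componentwise ones,
  and \<open>1\<close> is the all-ones vector.
\<close>

definition lp_feasible ::
    "real ^ 'n ^ 'n \<Rightarrow> real ^ 'm ^ 'n \<Rightarrow> real ^ 'n ^ 'm \<Rightarrow> real ^ 'n \<Rightarrow> real ^ 'm \<Rightarrow>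
     (real ^ 'n) \<times> (real ^ 'm) \<Rightarrow> bool" where
  "lp_feasible A B E s r = (\<lambda>(p, \<zeta>).
     0 \<le> p \<and> 0 \<le> \<zeta> \<and>
     transpose E *v \<zeta> - s \<le> transpose A *v p \<and>
     - \<zeta> \<le> r + transpose B *v p \<and> r + transpose B *v p \<le> \<zeta>)"

definition lp_objective :: "(real ^ 'n) \<times> (real ^ 'm) \<Rightarrow> real" where
  "lp_objective = (\<lambda>(p, \<zeta>). 1 \<bullet> p)"

end

theory Submission
  imports Defs
begin

text \<open>
  Put \<open>c = s - K\<^sup>T r\<close> and \<open>M = A - B K\<close>. Then \<open>c \<ge> 0\<close>, \<open>M\<close> is Metzler, and the equation
  for \<open>p\<close> reads \<open>M\<^sup>T p = - c\<close>, whereas every feasible \<open>q\<close> satisfies \<open>M\<^sup>T q \<ge> - c\<close>. Hence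
  \<open>M\<^sup>T (q - p) \<ge> 0\<close>. If \<open>q - p\<close> had a positive entry, its positive part \<open>u\<close> would be a nonzero
  nonnegative vector with \<open>M\<^sup>T u \<ge> 0\<close>, so Perron--Frobenius would provide a nonnegative
  eigenvector \<open>x\<close> of \<open>M\<close> for some eigenvalue \<open>\<lambda> \<ge> 0\<close>. Now \<open>\<lambda> p\<^sup>T x = - c\<^sup>T x\<close> with both sides
  of opposite sign gives \<open>c\<^sup>T x = 0\<close>, so \<open>x\<close> is unobservable but not stable.
\<close>

section \<open>Perron--Frobenius theory for nonnegative and Metzler matrices\<close>

definition std_simplex :: "(real ^ 'n) set" where
  "std_simplex = {x. (\<forall>i. 0 \<le> x $ i) \<and> 1 \<bullet> x = 1}"

lemma one_inner: "1 \<bullet> (x :: real ^ 'n) = (\<Sum>i\<in>UNIV. x $ i)"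
  by (simp add: inner_vec_def)

lemma std_simplex_le_one:
  assumes "x \<in> std_simplex"
  shows "x $ i \<le> 1"
proof -
  have "x $ i \<le> (\<Sum>i\<in>UNIV. x $ i)"
    using assms by (intro member_le_sum) (auto simp: std_simplex_def)
  then show ?thesis
    using assms by (simp add: std_simplex_def one_inner)
qed

lemma compact_std_simplex: "compact (std_simplex :: (real ^ 'n) set)"
proof -
  have "(std_simplex :: (real ^ 'n) set) \<subseteq> cbox 0 1"
  proof
    fix x :: "real ^ 'n" assume x: "x \<in> std_simplex"
    show "x \<in> cbox 0 1"
      using std_simplex_le_one[OF x] x by (simp add: mem_box_cart std_simplex_def)
  qed
  then have "bounded (std_simplex :: (real ^ 'n) set)"
    using bounded_cbox bounded_subset by blast
  moreover have "closed (std_simplex :: (real ^ 'n) set)"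
    unfolding std_simplex_def
    by (intro closed_Collect_conj closed_Collect_all closed_Collect_le closed_Collect_eq
        continuous_intros)
  ultimately show ?thesis
    by (simp add: compact_eq_bounded_closed)
qed

lemma convex_std_simplex: "convex (std_simplex :: (real ^ 'n) set)"
  by (auto simp: convex_def std_simplex_def inner_add_right)

lemma std_simplex_nonempty: "(std_simplex :: (real ^ 'n) set) \<noteq> {}"
proof -
  \<comment> \<open>A vertex of the simplex; \<open>undefined\<close> serves as an arbitrary
    index.\<close>
  have "axis undefined 1 \<in> (std_simplex :: (real ^ 'n) set)"
    by (auto simp: std_simplex_def inner_axis) (simp add: axis_def)
  then show ?thesis by blast
qed

text \<open>Brouwer's theorem for \<open>g\<close> normalised to entry sum 1. The term
  \<open>e *\<^sub>R 1\<close> keeps \<open>g\<close> strictly positive on the simplex even where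
  \<open>N *v x\<close> vanishes, so the division is continuous; the normalising factor at the fixed
  point becomes the eigenvalue.\<close>

lemma perturbed_eigenvector:
  fixes N :: "real ^ 'n ^ 'n"
  assumes N: "\<And>i j. 0 \<le> N $ i $ j" and e: "0 < e"
  obtains x \<rho> where "x \<in> std_simplex" and "N *v x + e *\<^sub>R 1 = \<rho> *\<^sub>R x"
proof -
  define g where "g x = N *v x + e *\<^sub>R 1" for x :: "real ^ 'n"
  have g_pos: "0 < g x $ i" if "x \<in> std_simplex" for x i
    using that e N
    by (auto simp: g_def std_simplex_def matrix_vector_mult_def
        intro!: add_nonneg_pos sum_nonneg)
  have sum_pos: "0 < 1 \<bullet> g x" if "x \<in> std_simplex" for x
    unfolding one_inner using g_pos[OF that] by (intro sum_pos) auto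
  have "continuous_on std_simplex (\<lambda>x. (1 / (1 \<bullet> g x)) *\<^sub>R g x)"
    using sum_pos unfolding g_def
    by (intro continuous_intros) (auto simp: less_le)
  moreover have "(\<lambda>x. (1 / (1 \<bullet> g x)) *\<^sub>R g x) \<in> std_simplex \<rightarrow> std_simplex"
  proof
    fix x :: "real ^ 'n" assume x: "x \<in> std_simplex"
    show "(1 / (1 \<bullet> g x)) *\<^sub>R g x \<in> std_simplex"
      using g_pos[OF x] sum_pos[OF x]
      by (auto simp: std_simplex_def less_imp_le)
  qed
  ultimately obtain x where x: "x \<in> std_simplex" "(1 / (1 \<bullet> g x)) *\<^sub>R g x = x"
    by (rule brouwer[OF compact_std_simplex convex_std_simplex std_simplex_nonempty])
  have "g x = (1 \<bullet> g x) *\<^sub>R x"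
    using arg_cong[OF x(2), of "\<lambda>y. (1 \<bullet> g x) *\<^sub>R y"] sum_pos[OF x(1)] by simp
  with x(1) show ?thesis
    unfolding g_def using that by blast
qed

text \<open>
  In the limit eigenvector \<open>u \<bullet> x\<close> may vanish, so \<open>t \<le> \<rho>\<close> cannot be read off there. The
  perturbation keeps \<open>u \<bullet> x\<close> positive, and the bound then passes to the limit.
\<close>

lemma perron_frobenius_subinvariant:
  fixes N :: "real ^ 'n ^ 'n" and u :: "real ^ 'n"
  assumes N: "\<And>i j. 0 \<le> N $ i $ j"
    and u: "\<And>i. 0 \<le> u $ i" "u \<noteq> 0"
    and sub: "\<And>j. t * u $ j \<le> (u v* N) $ j"
  obtains x \<rho> where "x \<in> std_simplex" and "N *v x = \<rho> *\<^sub>R x" and "t \<le> \<rho>"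
proof -
  have "\<exists>x \<rho>. x \<in> std_simplex \<and> N *v x + inverse (real (Suc k)) *\<^sub>R 1 = \<rho> *\<^sub>R x" for k
    by (rule perturbed_eigenvector[OF N, of "inverse (real (Suc k))"]) auto
  then obtain X R where X: "\<And>k. X k \<in> std_simplex"
    and R: "\<And>k. N *v X k + inverse (real (Suc k)) *\<^sub>R 1 = R k *\<^sub>R X k"
    by metis
  have u1: "0 < 1 \<bullet> u"
  proof -
    obtain i where "u $ i \<noteq> 0" using u(2) by (auto simp: vec_eq_iff)
    then show ?thesis
      unfolding one_inner using u(1) by (intro sum_pos2[of _ i]) (auto simp: less_le)
  qed
  have R_ge: "t \<le> R k" for k
  proof -
    have ux: "0 \<le> u \<bullet> X k"
      using u(1) X by (auto simp: inner_vec_def std_simplex_def intro!: sum_nonneg)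
    have "t * (u \<bullet> X k) \<le> (u v* N) \<bullet> X k"
      unfolding inner_vec_def sum_distrib_left inner_real_def mult.assoc[symmetric]
      using X by (intro sum_mono mult_right_mono sub) (auto simp: std_simplex_def)
    also have "\<dots> = u \<bullet> (N *v X k)"
      by (simp add: dot_lmul_matrix)
    finally have "t * (u \<bullet> X k) + inverse (real (Suc k)) * (1 \<bullet> u) \<le> R k * (u \<bullet> X k)"
      using arg_cong[OF R[of k], of "\<lambda>y. u \<bullet> y"]
      by (simp add: inner_add_right inner_commute)
    moreover have "0 < inverse (real (Suc k)) * (1 \<bullet> u)"
      using u1 by simp
    ultimately have "t * (u \<bullet> X k) < R k * (u \<bullet> X k)"
      by linarith
    then show ?thesis
      using ux mult_less_cancel_right by fastforce
  qed
  obtain x h where x: "x \<in> std_simplex" and h: "strict_mono h"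
    and lim: "(X \<circ> h) \<longlonglongrightarrow> x"
    using compact_std_simplex X unfolding compact_def by metis
  have "(\<lambda>k. inverse (real (Suc (h k)))) \<longlonglongrightarrow> 0"
    using LIMSEQ_subseq_LIMSEQ[OF LIMSEQ_inverse_real_of_nat h] by (simp add: o_def)
  then have lim': "(\<lambda>k. N *v X (h k) + inverse (real (Suc (h k))) *\<^sub>R 1) \<longlonglongrightarrow> N *v x + 0 *\<^sub>R 1"
    using lim unfolding o_def
    by (intro tendsto_intros bounded_linear.tendsto[OF matrix_vector_mul_bounded_linear])
  \<comment> \<open>As the entries of \<open>X k\<close> sum to 1, \<open>R k\<close> is the entry
    sum of the perturbed image of \<open>X k\<close>. Convergence of the vectors thus carries over
    to the eigenvalues.\<close>
  have R_eq: "1 \<bullet> (N *v X k + inverse (real (Suc k)) *\<^sub>R 1) = R k" for k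
    unfolding R using X[of k] by (simp add: std_simplex_def)
  have R_lim: "(\<lambda>k. R (h k)) \<longlonglongrightarrow> 1 \<bullet> (N *v x)"
    using tendsto_inner[OF tendsto_const[of 1] lim'] unfolding R_eq by simp
  have "(\<lambda>k. R (h k) *\<^sub>R X (h k)) \<longlonglongrightarrow> (1 \<bullet> (N *v x)) *\<^sub>R x"
    using tendsto_scaleR[OF R_lim] lim by (simp add: o_def)
  from LIMSEQ_unique[OF lim'[unfolded R] this]
  have "N *v x = (1 \<bullet> (N *v x)) *\<^sub>R x"
    by (simp only: scaleR_zero_left add_0_right)
  moreover have "t \<le> 1 \<bullet> (N *v x)"
    using R_lim R_ge by (intro LIMSEQ_le_const) auto
  ultimately show ?thesis
    using x that by blast
qed

text \<open>Adding \<open>t\<close> times the identity makes the matrix nonnegative, keeps its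
  eigenvectors and raises the subinvariance bound for \<open>u\<close> from 0 to \<open>t\<close>.
  Shifting back, an eigenvalue of at least \<open>t\<close> becomes a nonnegative one.\<close>

lemma metzler_nonneg_eigenvector:
  fixes M :: "real ^ 'n ^ 'n" and u :: "real ^ 'n"
  assumes M: "metzler M"
    and u: "\<And>i. 0 \<le> u $ i" "u \<noteq> 0"
    and uM: "\<And>j. 0 \<le> (u v* M) $ j"
  obtains x l where "x \<in> std_simplex" and "M *v x = l *\<^sub>R x" and "0 \<le> l"
proof -
  \<comment> \<open>This sum dominates each single \<open>- M $ i $ i\<close>, so the shifted
    diagonal is nonnegative.\<close>
  define t where "t = (\<Sum>i\<in>UNIV. \<bar>M $ i $ i\<bar>)"
  define N where "N = M + t *\<^sub>R mat 1"
  have t: "\<bar>M $ i $ i\<bar> \<le> t" for i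
    unfolding t_def by (intro member_le_sum) auto
  have "0 \<le> N $ i $ j" for i j
    using M t[of i] by (cases "i = j") (auto simp: N_def mat_def metzler_def)
  moreover have "u v* N = u v* M + t *\<^sub>R u"
    by (simp add: N_def vector_matrix_mult_add_rdistrib vector_scaleR_matrix_ac)
  then have "t * u $ j \<le> (u v* N) $ j" for j
    using uM[of j] by simp
  ultimately obtain x \<rho> where x: "x \<in> std_simplex" "N *v x = \<rho> *\<^sub>R x" "t \<le> \<rho>"
    using perron_frobenius_subinvariant[of N u t] u by metis
  have "N *v x = M *v x + t *\<^sub>R x"
    by (simp add: N_def matrix_vector_mult_add_rdistrib scaleR_matrix_vector_assoc[symmetric])
  then have "M *v x = (\<rho> - t) *\<^sub>R x"
    using x(2) by (simp add: scaleR_diff_left)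
  then show ?thesis
    using x that[of x "\<rho> - t"] by simp
qed

text \<open>If \<open>q $ j\<close> is positive, the diagonal term is unchanged and raising the
  other entries of \<open>q\<close> to 0 cannot decrease the sum, as they meet off-diagonal entries.
  Otherwise the diagonal entry, whose sign is unknown, is multiplied by 0.\<close>

lemma metzler_positive_part:
  fixes M :: "real ^ 'n ^ 'n" and q :: "real ^ 'n"
  assumes M: "metzler M" and q: "\<And>j. 0 \<le> (q v* M) $ j"
  shows "0 \<le> ((\<chi> i. max 0 (q $ i)) v* M) $ j"
proof (cases "0 < q $ j")
  case True
  have "(q v* M) $ j \<le> ((\<chi> i. max 0 (q $ i)) v* M) $ j"
    unfolding vector_matrix_mult_def vec_lambda_beta
  proof (rule sum_mono)
    fix i
    show "q $ i * M $ i $ j \<le> max 0 (q $ i) * M $ i $ j"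
      using True M by (cases "i = j") (auto simp: metzler_def intro: mult_right_mono)
  qed
  then show ?thesis using q[of j] by simp
next
  case False
  show ?thesis
    unfolding vector_matrix_mult_def vec_lambda_beta
  proof (rule sum_nonneg)
    fix i
    show "0 \<le> max 0 (q $ i) * M $ i $ j"
      using False M by (cases "i = j") (auto simp: metzler_def)
  qed
qed

section \<open>Eigenvectors, trajectories and detectability\<close>

lemma trajectory_eigenvector:
  assumes "M *v x = l *\<^sub>R x"
  shows "trajectory M (\<lambda>t. exp (l * t) *\<^sub>R x)"
  unfolding trajectory_def
  by (auto simp: matrix_vector_mult_scaleR assms mult.commute intro!: derivative_eq_intros)

text \<open>The trajectory \<open>exp (l * t) *\<^sub>R x\<close> never gets smaller in norm than
  \<open>x\<close>, so it does not tend to 0; if \<open>C *v x\<close> were 0, its output would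
  vanish throughout.\<close>

lemma detectable_eigenvector_observable:
  fixes C :: "real ^ 'n ^ 'k" and x :: "real ^ 'n"
  assumes "detectable C M" and eig: "M *v x = l *\<^sub>R x" and l: "0 \<le> l" and x: "x \<noteq> 0"
  shows "C *v x \<noteq> 0"
proof
  assume "C *v x = 0"
  then have "unobservable_state C M x"
    unfolding unobservable_state_def
    using trajectory_eigenvector[OF eig]
    by (intro exI[of _ "\<lambda>t. exp (l * t) *\<^sub>R x"]) (auto simp: matrix_vector_mult_scaleR)
  then have "asymptotically_stable_state M x"
    using assms(1) by (simp add: detectable_def)
  then have "((\<lambda>t. exp (l * t) *\<^sub>R x) \<longlongrightarrow> 0) at_top"
    using trajectory_eigenvector[OF eig] by (simp add: asymptotically_stable_state_def)
  then have "((\<lambda>t. norm (exp (l * t) *\<^sub>R x)) \<longlongrightarrow> 0) at_top"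
    by (rule tendsto_norm_zero)
  moreover have "\<forall>\<^sub>F t in at_top. norm x \<le> norm (exp (l * t) *\<^sub>R x)"
    using eventually_ge_at_top[of 0]
  proof eventually_elim
    case (elim t)
    then have "1 \<le> exp (l * t)" using l by simp
    then show ?case by (simp add: mult_le_cancel_right1)
  qed
  ultimately have "norm x \<le> 0"
    by (rule tendsto_lowerbound) simp
  then show False using x by simp
qed

text \<open>Comparison principle, later applied to the difference of a feasible point and
  \<open>p\<close>. Here \<open>p\<close> acts as a multiplier: it forces
  \<open>c \<bullet> x = 0\<close> for every nonnegative eigenvector \<open>x\<close> with
  eigenvalue at least 0.\<close>

lemma detectable_metzler_nonpos:
  fixes M :: "real ^ 'n ^ 'n" and p q c :: "real ^ 'n"
  assumes M: "metzler M" and p: "0 \<le> p" and c: "0 \<le> c" and pM: "p v* M = - c"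
    and det: "detectable (rowvector c :: real ^ 'n ^ 1) M"
    and qM: "0 \<le> q v* M"
  shows "q \<le> 0"
proof (rule ccontr)
  assume "\<not> q \<le> 0"
  then obtain i where i: "0 < q $ i"
    by (auto simp: less_eq_vec_def not_le)
  define u :: "real ^ 'n" where "u = (\<chi> i. max 0 (q $ i))"
  have "u $ i \<noteq> 0" using i by (simp add: u_def)
  then have "u \<noteq> 0" by auto
  moreover have "0 \<le> (u v* M) $ j" for j
    unfolding u_def using qM by (intro metzler_positive_part[OF M]) (simp add: less_eq_vec_def)
  moreover have "0 \<le> u $ i" for i
    by (simp add: u_def)
  ultimately obtain x l where x: "x \<in> std_simplex" "M *v x = l *\<^sub>R x" "0 \<le> l"
    using metzler_nonneg_eigenvector[OF M] by metis
  have nonneg: "0 \<le> y \<bullet> x" if "0 \<le> y" for y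
    using that x(1) by (auto simp: inner_vec_def std_simplex_def less_eq_vec_def intro!: sum_nonneg)
  have "l * (p \<bullet> x) = - (c \<bullet> x)"
    using dot_lmul_matrix[of p M x] pM x(2) by simp
  moreover have "0 \<le> l * (p \<bullet> x)"
    using nonneg[OF p] x(3) by simp
  ultimately have "c \<bullet> x = 0"
    using nonneg[OF c] by linarith
  then have "(rowvector c :: real ^ 'n ^ 1) *v x = 0"
    by (simp add: vec_eq_iff rowvector_def matrix_vector_mult_def inner_vec_def)
  moreover have "x \<noteq> 0"
    using x(1) by (auto simp: std_simplex_def)
  ultimately show False
    using detectable_eigenvector_observable[OF det x(2,3)] by blast
qed

section \<open>Sign selections and optimality in the linear program\<close>

lemma sign_set_abs_le: "\<sigma> \<in> sign_set y \<Longrightarrow> \<bar>\<sigma>\<bar> \<le> 1"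
  by (auto simp: sign_set_def split: if_splits)

lemma sign_set_mult: "\<sigma> \<in> sign_set y \<Longrightarrow> \<sigma> * y = \<bar>y\<bar>"
  by (auto simp: sign_set_def split: if_splits)

theorem theorem12:
  fixes A :: "real ^ 'n ^ 'n" and B :: "real ^ 'm ^ 'n" and E :: "real ^ 'n ^ 'm"
    and s :: "real ^ 'n" and r :: "real ^ 'm"
    and p :: "real ^ 'n" and K :: "real ^ 'n ^ 'm"
  assumes "0 \<le> E"
    and "\<And>i. row i E \<noteq> 0"
    and "metzler (A - \<bar>B\<bar> ** E)"
    and "transpose E *v \<bar>r\<bar> \<le> s"
    and "0 \<le> p"
    and "transpose A *v p = transpose E *v \<bar>r + transpose B *v p\<bar> - s"
    and "\<And>i. \<exists>\<sigma>\<in>sign_set (r $ i + p \<bullet> column i B). row i K = \<sigma> *\<^sub>R row i E"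
    and "detectable (rowvector (s - r v* K) :: real ^ 'n ^ 1) (A - B ** K)"
  shows "is_arg_max lp_objective (lp_feasible A B E s r) (p, \<bar>r + transpose B *v p\<bar>)"
proof -
  have E: "0 \<le> E $ i $ j" for i j
    using assms(1) by (simp add: less_eq_vec_def)
  have Bp: "(transpose B *v p) $ i = p \<bullet> column i B" for i
    by (simp add: matrix_vector_mult_def transpose_def inner_vec_def column_def mult.commute)
  obtain \<sigma> where \<sigma>: "\<And>i. \<sigma> i \<in> sign_set ((r + transpose B *v p) $ i)"
    and K: "\<And>i. row i K = \<sigma> i *\<^sub>R row i E"
    using assms(7) unfolding vector_add_component Bp by metis
  have K: "K $ i $ j = \<sigma> i * E $ i $ j" for i j
    using arg_cong[OF K[of i], of "\<lambda>y. y $ j"] by (simp add: row_def)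
  have KE: "\<bar>K $ i $ j\<bar> \<le> E $ i $ j" for i j
    using sign_set_abs_le[OF \<sigma>[of i]] E[of i j] by (simp add: K abs_mult mult_left_le_one_le)
  \<comment> \<open>With \<open>y = r\<close> this yields \<open>0 \<le> ?c\<close>; with
    \<open>y = r + transpose B *v q\<close> it turns the constraints on a feasible \<open>q\<close>
    into a bound on \<open>q v* ?M\<close>.\<close>
  have yK: "y v* K \<le> transpose E *v z" if "\<bar>y\<bar> \<le> z" for y z
    unfolding less_eq_vec_def transpose_matrix_vector vector_matrix_mult_def vec_lambda_beta
  proof (intro allI sum_mono)
    fix i j
    have "y $ i * K $ i $ j \<le> \<bar>y $ i\<bar> * \<bar>K $ i $ j\<bar>"
      by (metis abs_ge_self abs_mult)
    also have "\<dots> \<le> z $ i * E $ i $ j"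
      using that KE by (intro mult_mono) (auto simp: less_eq_vec_def abs_vec_def
          intro: order_trans[OF abs_ge_zero])
    finally show "y $ i * K $ i $ j \<le> z $ i * E $ i $ j" .
  qed
  \<comment> \<open>Adding and subtracting \<open>r v* K\<close> makes the residual
    \<open>r + transpose B *v q\<close> appear as the factor of \<open>K\<close>.\<close>
  have split: "q v* (A - B ** K)
      = transpose A *v q - (r + transpose B *v q) v* K + r v* K" for q
    by (simp add: algebra_simps vector_matrix_mul_assoc)
  let ?M = "A - B ** K" and ?c = "s - r v* K"
  have "metzler ?M"
    unfolding metzler_def
  proof (intro allI impI)
    fix i j :: 'n assume "i \<noteq> j"
    then have "0 \<le> (A - \<bar>B\<bar> ** E) $ i $ j"
      using assms(3) by (simp add: metzler_def)
    also have "\<dots> \<le> ?M $ i $ j"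
      unfolding matrix_matrix_mult_def vector_minus_component vec_lambda_beta
    proof (intro diff_left_mono sum_mono)
      fix k
      have "B $ i $ k * K $ k $ j \<le> \<bar>B $ i $ k\<bar> * \<bar>K $ k $ j\<bar>"
        by (metis abs_ge_self abs_mult)
      also have "\<dots> \<le> \<bar>B\<bar> $ i $ k * E $ k $ j"
        using KE by (auto simp: abs_vec_def intro!: mult_left_mono)
      finally show "B $ i $ k * K $ k $ j \<le> \<bar>B\<bar> $ i $ k * E $ k $ j" .
    qed
    finally show "0 \<le> ?M $ i $ j" .
  qed
  moreover have "0 \<le> ?c"
    using yK[of r "\<bar>r\<bar>"] assms(4) by (simp add: order_trans)
  \<comment> \<open>At \<open>p\<close> the signs in \<open>K\<close> match those of the residual,
    so the bound \<open>yK\<close> is attained with equality.\<close>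
  moreover have "(r + transpose B *v p) $ i * K $ i $ j
      = \<bar>r + transpose B *v p\<bar> $ i * E $ i $ j" for i j
    unfolding abs_vec_def vec_lambda_beta K sign_set_mult[OF \<sigma>[of i], symmetric]
    by (simp only: mult_ac)
  then have "(r + transpose B *v p) v* K = transpose E *v \<bar>r + transpose B *v p\<bar>"
    by (simp only: transpose_matrix_vector vector_matrix_mult_def)
  then have pM: "p v* ?M = - ?c"
    using assms(6) by (simp add: split)
  moreover have "0 \<le> (q - p) v* ?M" if "lp_feasible A B E s r (q, \<zeta>)" for q \<zeta>
  proof -
    have feas: "transpose E *v \<zeta> - s \<le> transpose A *v q"
      "- \<zeta> \<le> r + transpose B *v q" "r + transpose B *v q \<le> \<zeta>"
      using that by (auto simp: lp_feasible_def)
    have "\<bar>r + transpose B *v q\<bar> \<le> \<zeta>"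
      using feas(2,3) by (simp add: less_eq_vec_def abs_vec_def abs_le_iff) (smt (verit))
    \<comment> \<open>The bound \<open>yK\<close> cancels \<open>transpose E *v \<zeta>\<close> in
      the first constraint, leaving \<open>- ?c\<close>.\<close>
    from yK[OF this] feas(1) have "- ?c \<le> q v* ?M"
      unfolding split by (simp add: algebra_simps less_eq_vec_def) (smt (verit))
    then show ?thesis
      using pM by (simp add: vector_matrix_mult_diff_distrib)
  qed
  ultimately have "q - p \<le> 0" if "lp_feasible A B E s r (q, \<zeta>)" for q \<zeta>
    using detectable_metzler_nonpos[OF _ assms(5) _ _ assms(8)] that by blast
  \<comment> \<open>The objective sums the entries of the first component only, so
    \<open>q \<le> p\<close> settles the comparison.\<close>
  then have "lp_objective (q, \<zeta>) \<le> lp_objective (p, \<zeta>')" if "lp_feasible A B E s r (q, \<zeta>)"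
    for q \<zeta> and \<zeta>' :: "real ^ 'm"
    using that by (auto simp: lp_objective_def one_inner less_eq_vec_def intro!: sum_mono)
  moreover have "lp_feasible A B E s r (p, \<bar>r + transpose B *v p\<bar>)"
    using assms(5,6) by (auto simp: lp_feasible_def less_eq_vec_def abs_vec_def abs_le_iff)
  ultimately show ?thesis
    by (auto simp: is_arg_max_def not_less)
qed

end
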